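(* Let $G$ be a compact Hausdorff topological group and let $p\colon E\to B$ and $f\colon K\to B$ be $G$-maps of $G$-spaces. Then $\mathrm{secat}_{G,f}(p)\le \mathrm{secat}_G(p)$.
   Context: A $G$-space is a Hausdorff space with a continuous left $G$-action; a $G$-map is a continuous $G$-equivariant map. Two $G$-maps $u,v\colon X\to Y$ are $G$-homotopic, written $u\simeq_G v$, if there is a $G$-map $X\times I\to Y$ (with $I=[0,1]$ carrying the trivial action) restricting to $u$ and $v$ at the ends. The equivariant relative sectional category $\mathrm{secat}_{G,f}(p)$ is the smallest non-negative integer $n$ such that there is a $G$-invariant open cover $\{U_0,\dots,U_n\}$ of $K$ with $G$-maps $s_i\colon U_i\to E$ satisfying $p\circ s_i\simeq_G f|_{U_i}$ for each $i$ ($\infty$ if there is no such $n$). The equivariant sectional category $\mathrm{secat}_G(p)$ is the least non-negative integer $n$ such that there is a cover of $B$ by $G$-invariant open subsets $U_0,\dots,U_n$ and, for each $i$, a $G$-map $s_i\colon U_i\to E$ with $p\circ s_i\simeq_G \iota_{U_i}$, where $\iota_{U_i}\colon U_i\hookrightarrow B$ is the inclusion ($\infty$ if there is no such $n$). *)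

theory Defs
  imports "HOL-Analysis.Analysis" "HOL-Algebra.Group_Action"
begin

locale topological_group = group G for G (structure) +
  fixes T :: "'a topology"
  assumes topspace_eq: "topspace T = carrier G"
    and continuous_mult: "continuous_map (prod_topology T T) T (\<lambda>(g, h). g \<otimes> h)"
    and continuous_inv: "continuous_map T T (\<lambda>g. inv g)"

record ('g, 'a) gspace =
  top_of :: "'a topology"
  act :: "'g \<Rightarrow> 'a \<Rightarrow> 'a"

abbreviation points :: "('g, 'a) gspace \<Rightarrow> 'a set" where
  "points X \<equiv> topspace (top_of X)"

definition G_space :: "('g, 'm) monoid_scheme \<Rightarrow> 'g topology \<Rightarrow> ('g, 'a) gspace \<Rightarrow> bool" where
  "G_space G T X \<longleftrightarrow>
     Hausdorff_space (top_of X) \<and>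
     group_action G (points X) (act X) \<and>
     continuous_map (prod_topology T (top_of X)) (top_of X) (\<lambda>(g, x). act X g x)"

definition G_map ::
  "('g, 'm) monoid_scheme \<Rightarrow> ('g, 'a) gspace \<Rightarrow> ('g, 'b) gspace \<Rightarrow> ('a \<Rightarrow> 'b) \<Rightarrow> bool" where
  "G_map G X Y u \<longleftrightarrow>
     continuous_map (top_of X) (top_of Y) u \<and>
     (\<forall>g \<in> carrier G. \<forall>x \<in> points X. u (act X g x) = act Y g (u x))"

definition G_invariant :: "('g, 'm) monoid_scheme \<Rightarrow> ('g, 'a) gspace \<Rightarrow> 'a set \<Rightarrow> bool" where
  "G_invariant G X U \<longleftrightarrow> (\<forall>g \<in> carrier G. act X g ` U \<subseteq> U)"

text \<open>
  The actions below are restricted to the underlying set because \<^const>\<open>group_action\<close>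
  is stated with extensional bijections.
\<close>

definition G_subspace :: "('g, 'a) gspace \<Rightarrow> 'a set \<Rightarrow> ('g, 'a) gspace" where
  "G_subspace X U =
     \<lparr>top_of = subtopology (top_of X) U,
      act = (\<lambda>g. restrict (act X g) (points X \<inter> U))\<rparr>"

definition G_cylinder :: "('g, 'a) gspace \<Rightarrow> ('g, 'a \<times> real) gspace" where
  "G_cylinder X =
     \<lparr>top_of = prod_topology (top_of X) (top_of_set {0..1}),
      act = (\<lambda>g. restrict (\<lambda>(x, t). (act X g x, t)) (points X \<times> {0..1}))\<rparr>"

definition G_homotopic ::
  "('g, 'm) monoid_scheme \<Rightarrow> ('g, 'a) gspace \<Rightarrow> ('g, 'b) gspace
     \<Rightarrow> ('a \<Rightarrow> 'b) \<Rightarrow> ('a \<Rightarrow> 'b) \<Rightarrow> bool" where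
  "G_homotopic G X Y u v \<longleftrightarrow>
     (\<exists>H. G_map G (G_cylinder X) Y H \<and>
          (\<forall>x \<in> points X. H (x, 0) = u x) \<and>
          (\<forall>x \<in> points X. H (x, 1) = v x))"

text \<open>
  Both invariants are infima in \<^typ>\<open>enat\<close>; the infimum of the empty set is \<open>\<infinity>\<close>.
  The members of a cover may repeat or be empty.
\<close>

definition secat_rel ::
  "('g, 'm) monoid_scheme \<Rightarrow> ('g, 'k) gspace \<Rightarrow> ('g, 'e) gspace \<Rightarrow> ('g, 'b) gspace
     \<Rightarrow> ('k \<Rightarrow> 'b) \<Rightarrow> ('e \<Rightarrow> 'b) \<Rightarrow> enat" where
  "secat_rel G K E B f p =
     Inf {enat n | n. \<exists>U :: nat \<Rightarrow> 'k set.
       (\<Union>i\<le>n. U i) = points K \<and>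
       (\<forall>i\<le>n. openin (top_of K) (U i) \<and> G_invariant G K (U i) \<and>
          (\<exists>s. G_map G (G_subspace K (U i)) E s \<and>
               G_homotopic G (G_subspace K (U i)) B (p \<circ> s) (restrict f (U i))))}"

definition secat ::
  "('g, 'm) monoid_scheme \<Rightarrow> ('g, 'e) gspace \<Rightarrow> ('g, 'b) gspace \<Rightarrow> ('e \<Rightarrow> 'b) \<Rightarrow> enat" where
  "secat G E B p =
     Inf {enat n | n. \<exists>U :: nat \<Rightarrow> 'b set.
       (\<Union>i\<le>n. U i) = points B \<and>
       (\<forall>i\<le>n. openin (top_of B) (U i) \<and> G_invariant G B (U i) \<and>
          (\<exists>s. G_map G (G_subspace B (U i)) E s \<and>
               G_homotopic G (G_subspace B (U i)) B (p \<circ> s) (\<lambda>x. x)))}"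

lemma G_space_subspace:
  assumes X: "G_space G T X" and U: "G_invariant G X U" "U \<subseteq> points X"
    and T: "topological_group G T"
  shows "G_space G T (G_subspace X U)"
proof -
  interpret topological_group G T by (rule T)
  interpret group_action G "points X" "act X" using X by (simp add: G_space_def)
  have inv: "act X g x \<in> U" if "g \<in> carrier G" "x \<in> U" for g x
    using that U by (auto simp: G_invariant_def)
  have UX: "x \<in> points X" if "x \<in> U" for x using that U by auto
  have top: "points (G_subspace X U) = U" "points X \<inter> U = U"
    using U by (auto simp: G_subspace_def)
  have bij: "restrict (act X g) U \<in> Bij U" if g: "g \<in> carrier G" for g
  proof -
    have "bij_betw (act X g) U U"
    proof (rule bij_betwI[where g = "act X (inv\<^bsub>G\<^esub> g)"])
      show "act X g \<in> U \<rightarrow> U" "act X (inv\<^bsub>G\<^esub> g) \<in> U \<rightarrow> U" using inv g by auto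
      show "act X (inv\<^bsub>G\<^esub> g) (act X g x) = x" if "x \<in> U" for x
        using orbit_sym_aux[OF g UX[OF that]] by simp
      show "act X g (act X (inv\<^bsub>G\<^esub> g) x) = x" if "x \<in> U" for x
        using orbit_sym_aux[OF inv_closed[OF g] UX[OF that]] g by simp
    qed
    then show ?thesis by (simp add: Bij_def)
  qed
  have "group_action G U (\<lambda>g. restrict (act X g) U)"
    unfolding group_action_def group_hom_def group_hom_axioms_def
  proof (intro conjI homI)
    show "group G" by (rule is_group)
    show "group (BijGroup U)" by (rule group_BijGroup)
  next
    fix g assume "g \<in> carrier G"
    then show "restrict (act X g) U \<in> carrier (BijGroup U)"
      using bij by (simp add: BijGroup_def)
  next
    fix g h assume "g \<in> carrier G" "h \<in> carrier G"
    then show "restrict (act X (g \<otimes>\<^bsub>G\<^esub> h)) U =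
        restrict (act X g) U \<otimes>\<^bsub>BijGroup U\<^esub> restrict (act X h) U"
      using bij inv UX composition_rule
      by (auto simp: BijGroup_def compose_def fun_eq_iff restrict_def)
  qed
  moreover have "continuous_map (prod_topology T (subtopology (top_of X) U))
     (subtopology (top_of X) U) (\<lambda>(g, x). restrict (act X g) U x)"
  proof -
    have "continuous_map (prod_topology T (subtopology (top_of X) U)) (top_of X)
        (\<lambda>(g, x). act X g x)"
      using X unfolding G_space_def
      by (metis continuous_map_from_subtopology prod_topology_subtopology(2))
    then have "continuous_map (prod_topology T (subtopology (top_of X) U)) (top_of X)
        (\<lambda>(g, x). restrict (act X g) U x)"
      by (rule continuous_map_eq) auto
    then show ?thesis
      using inv by (auto simp: continuous_map_in_subtopology topspace_eq)
  qed
  ultimately show ?thesis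
    using X U top by (auto simp: G_space_def G_subspace_def Hausdorff_space_subtopology Int_absorb1)
qed

lemma G_space_cylinder:
  assumes X: "G_space G T X" and T: "topological_group G T"
  shows "G_space G T (G_cylinder X)"
proof -
  interpret topological_group G T by (rule T)
  interpret group_action G "points X" "act X" using X by (simp add: G_space_def)
  have clo: "act X g x \<in> points X" if "g \<in> carrier G" "x \<in> points X" for g x
    using element_image[OF that refl] .
  let ?I = "{0..1::real}"
  let ?a = "\<lambda>g. restrict (\<lambda>(x, t). (act X g x, t)) (points X \<times> ?I)"
  have bij: "?a g \<in> Bij (points X \<times> ?I)" if g: "g \<in> carrier G" for g
  proof -
    have "bij_betw (\<lambda>(x, t). (act X g x, t)) (points X \<times> ?I) (points X \<times> ?I)"
    proof (rule bij_betwI[where g = "\<lambda>(x, t). (act X (inv\<^bsub>G\<^esub> g) x, t)"], goal_cases)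
      case 1 show ?case using clo g by auto
      case 2 show ?case using clo g by auto
      case (3 z) then show ?case using orbit_sym_aux[OF g] by auto
      case (4 z) then show ?case using orbit_sym_aux[OF inv_closed[OF g]] g by auto
    qed
    then show ?thesis by (simp add: Bij_def)
  qed
  have "group_action G (points X \<times> ?I) ?a"
    unfolding group_action_def group_hom_def group_hom_axioms_def
  proof (intro conjI homI)
    show "group G" by (rule is_group)
    show "group (BijGroup (points X \<times> ?I))" by (rule group_BijGroup)
  next
    fix g assume "g \<in> carrier G"
    then show "?a g \<in> carrier (BijGroup (points X \<times> ?I))"
      using bij by (simp add: BijGroup_def)
  next
    fix g h assume "g \<in> carrier G" "h \<in> carrier G"
    then show "?a (g \<otimes>\<^bsub>G\<^esub> h) = ?a g \<otimes>\<^bsub>BijGroup (points X \<times> ?I)\<^esub> ?a h"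
      using bij clo composition_rule
      by (auto simp: BijGroup_def compose_def fun_eq_iff restrict_def)
  qed
  moreover have "continuous_map (prod_topology T (prod_topology (top_of X) (top_of_set ?I)))
     (prod_topology (top_of X) (top_of_set ?I)) (\<lambda>(g, z). ?a g z)"
  proof -
    let ?P = "prod_topology T (prod_topology (top_of X) (top_of_set ?I))"
    have "continuous_map ?P (prod_topology T (top_of X)) (\<lambda>w. (fst w, fst (snd w)))"
      by (intro continuous_map_pairedI continuous_map_fst continuous_map_fst_of[unfolded o_def]
          continuous_map_compose[OF continuous_map_snd continuous_map_fst, unfolded o_def])
    from continuous_map_compose[OF this, of "top_of X" "\<lambda>(g, x). act X g x"]
    have "continuous_map ?P (top_of X) (\<lambda>w. act X (fst w) (fst (snd w)))"
      using X by (simp add: G_space_def o_def)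
    moreover have "continuous_map ?P (top_of_set ?I) (\<lambda>w. snd (snd w))"
      by (intro continuous_map_compose[OF continuous_map_snd continuous_map_snd, unfolded o_def])
    ultimately have "continuous_map ?P (prod_topology (top_of X) (top_of_set ?I))
        (\<lambda>w. (act X (fst w) (fst (snd w)), snd (snd w)))"
      by (rule continuous_map_pairedI)
    then show ?thesis by (rule continuous_map_eq) auto
  qed
  ultimately show ?thesis
    using X by (auto simp: G_space_def G_cylinder_def Hausdorff_space_prod_topology
        Hausdorff_space_subtopology)
qed

end

theory Submission
  imports Defs
begin

text \<open>
  Covers pull back along \<open>f\<close>. Let \<open>U\<close> be an invariant open subset of \<open>B\<close> with a \<open>G\<close>-map
  \<open>s : U \<rightarrow> E\<close> and a \<open>G\<close>-homotopy \<open>H : p \<circ> s \<simeq> \<iota>\<close>. Then \<open>V = f\<^sup>-\<^sup>1(U)\<close> is invariant and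
  open in \<open>K\<close>, the restriction \<open>f : V \<rightarrow> U\<close> is a \<open>G\<close>-map, and precomposing with it turns \<open>s\<close>
  into the local section \<open>s \<circ> f : V \<rightarrow> E\<close> and \<open>H\<close> into the homotopy
  \<open>H \<circ> (f \<times> id) : p \<circ> s \<circ> f \<simeq> f|\<^sub>V\<close>. So each number of sets admissible for \<open>secat\<close> is
  admissible for \<open>secat_rel\<close>, and the infimum over the larger set of numbers is the smaller one.
  Everything rests on the functoriality of \<open>G\<close>-maps under composition
  (\<open>G_map_compose\<close>), restriction to subspaces (\<open>G_map_restrict\<close>) and formation of cylinders
  (\<open>G_map_cylinder\<close>).
\<close>

lemma G_map_compose:
  assumes "G_map G X Y u" and "G_map G Y Z v"
  shows "G_map G X Z (v \<circ> u)"
proof -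
  have "u x \<in> points Y" if "x \<in> points X" for x
    using assms(1) that by (auto simp: G_map_def continuous_map_def)
  then show ?thesis
    using assms by (auto simp: G_map_def intro: continuous_map_compose)
qed

lemma G_map_restrict:
  assumes "G_map G X Y u" and "u ` (points X \<inter> V) \<subseteq> U"
  shows "G_map G (G_subspace X V) (G_subspace Y U) u"
  using assms
  by (auto simp: G_map_def G_subspace_def continuous_map_in_subtopology
      continuous_map_from_subtopology continuous_map_def[of "top_of X"])

lemma G_map_cylinder:
  assumes "G_map G X Y u"
  shows "G_map G (G_cylinder X) (G_cylinder Y) (\<lambda>(x, t). (u x, t))"
proof -
  have "u x \<in> points Y" if "x \<in> points X" for x
    using assms that by (auto simp: G_map_def continuous_map_def)
  moreover have "continuous_map (prod_topology (top_of X) (top_of_set {0..1::real}))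
      (prod_topology (top_of Y) (top_of_set {0..1})) (\<lambda>(x, t). (u x, t))"
    using assms by (simp add: G_map_def continuous_map_prod_top)
  ultimately show ?thesis
    using assms by (auto simp: G_map_def G_cylinder_def)
qed

text \<open>
  The hypotheses compare the end maps on the points of \<open>X\<close> only: the values of a map outside
  the space are arbitrary, and it is there that \<open>f\<close> and its \<^const>\<open>restrict\<close> differ.
\<close>

lemma G_homotopic_precompose:
  assumes h: "G_map G X Y h" and uv: "G_homotopic G Y Z u v"
    and u': "\<And>x. x \<in> points X \<Longrightarrow> u' x = u (h x)"
    and v': "\<And>x. x \<in> points X \<Longrightarrow> v' x = v (h x)"
  shows "G_homotopic G X Z u' v'"
proof -
  from uv obtain H where H: "G_map G (G_cylinder Y) Z H"
    and ends: "\<And>y. y \<in> points Y \<Longrightarrow> H (y, 0) = u y" "\<And>y. y \<in> points Y \<Longrightarrow> H (y, 1) = v y"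
    by (auto simp: G_homotopic_def)
  have "h x \<in> points Y" if "x \<in> points X" for x
    using h that by (auto simp: G_map_def continuous_map_def)
  moreover have "G_map G (G_cylinder X) Z (H \<circ> (\<lambda>(x, t). (h x, t)))"
    using G_map_cylinder[OF h] H by (rule G_map_compose)
  ultimately show ?thesis
    unfolding G_homotopic_def using ends u' v' by (intro exI conjI) auto
qed

lemma G_invariant_preimage:
  assumes X: "G_space G T X" and u: "G_map G X Y u" and U: "G_invariant G Y U"
  shows "G_invariant G X {x \<in> points X. u x \<in> U}"
proof -
  interpret group_action G "points X" "act X" using X by (simp add: G_space_def)
  have "act X g x \<in> points X" if "g \<in> carrier G" "x \<in> points X" for g x
    using element_image[OF that refl] .
  then show ?thesis
    using u U by (auto simp: G_invariant_def G_map_def image_subset_iff)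
qed

theorem proposition3p5:
  fixes G :: "('g, 'm) monoid_scheme" and T :: "'g topology"
    and E :: "('g, 'e) gspace" and B :: "('g, 'b) gspace" and K :: "('g, 'k) gspace"
    and p :: "'e \<Rightarrow> 'b" and f :: "'k \<Rightarrow> 'b"
  assumes "topological_group G T" and "compact_space T" and "Hausdorff_space T"
    and "G_space G T E" and "G_space G T B" and "G_space G T K"
    and "G_map G E B p" and "G_map G K B f"
  shows "secat_rel G K E B f p \<le> secat G E B p"
  unfolding secat_rel_def secat_def
proof (rule Inf_superset_mono, clarsimp)
  fix n and U :: "nat \<Rightarrow> 'b set"
  assume cover: "(\<Union>i\<le>n. U i) = points B"
    and sections: "\<forall>i\<le>n. openin (top_of B) (U i) \<and> G_invariant G B (U i) \<and>
      (\<exists>s. G_map G (G_subspace B (U i)) E s \<and>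
           G_homotopic G (G_subspace B (U i)) B (p \<circ> s) (\<lambda>x. x))"
  define V where "V i = {x \<in> points K. f x \<in> U i}" for i
  have f: "continuous_map (top_of K) (top_of B) f"
    using assms(8) by (simp add: G_map_def)
  have "f x \<in> (\<Union>i\<le>n. U i)" if "x \<in> points K" for x
    unfolding cover using f that by (auto simp: continuous_map_def)
  then have "(\<Union>i\<le>n. V i) = points K"
    by (auto simp: V_def)
  moreover have "openin (top_of K) (V i) \<and> G_invariant G K (V i) \<and>
      (\<exists>s. G_map G (G_subspace K (V i)) E s \<and>
           G_homotopic G (G_subspace K (V i)) B (p \<circ> s) (restrict f (V i)))" if "i \<le> n" for i
  proof -
    from sections that obtain s where Ui: "openin (top_of B) (U i)" "G_invariant G B (U i)"
      and s: "G_map G (G_subspace B (U i)) E s"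
      and hom: "G_homotopic G (G_subspace B (U i)) B (p \<circ> s) (\<lambda>x. x)"
      by blast
    have fV: "G_map G (G_subspace K (V i)) (G_subspace B (U i)) f"
      using assms(8) by (rule G_map_restrict) (auto simp: V_def)
    have "openin (top_of K) (V i)"
      unfolding V_def using f Ui(1) by (rule openin_continuous_map_preimage)
    moreover have "G_invariant G K (V i)"
      unfolding V_def using assms(6,8) Ui(2) by (rule G_invariant_preimage)
    moreover have "G_map G (G_subspace K (V i)) E (s \<circ> f)"
      using fV s by (rule G_map_compose)
    moreover have "G_homotopic G (G_subspace K (V i)) B (p \<circ> (s \<circ> f)) (restrict f (V i))"
      using fV hom by (rule G_homotopic_precompose) (auto simp: G_subspace_def)
    ultimately show ?thesis
      by blast
  qed
  ultimately show "\<exists>U. (\<Union>i\<le>n. U i) = points K \<and>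
      (\<forall>i\<le>n. openin (top_of K) (U i) \<and> G_invariant G K (U i) \<and>
         (\<exists>s. G_map G (G_subspace K (U i)) E s \<and>
              G_homotopic G (G_subspace K (U i)) B (p \<circ> s) (restrict f (U i))))"
    by blast
qed

end
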